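(* Let $m,n,k>0$ be real numbers, let $\Lambda=\Lambda_{11}+\Lambda_{21}+i(\Lambda_{12}+\Lambda_{22})$ with $\Lambda_{11},\Lambda_{12},\Lambda_{21},\Lambda_{22}\in\mathbb{R}$, and let $\beta=\beta_1+i\beta_2$, $\gamma=\gamma_1+i\gamma_2$ with $\beta_1,\beta_2,\gamma_1,\gamma_2\in\mathbb{R}$. If $\beta_1^2+\beta_2^2<1$, $\gamma_1^2+\gamma_2^2<1$ and $\Lambda_{11}+\Lambda_{21}\ge 0$, and if a solution of Problem A (defined in the context, with these parameters) exists, then it is unique; that is, any two solutions of Problem A coincide on $\overline\Omega$.
   Context: Let $\Omega=\{(x,y,t)\in\mathbb{R}^3: 0<x<1,\ 0<y<1,\ 0<t<1\}$ be the open unit cube, and let $S_2=\{x=1,\ 0<y<1,\ 0<t<1\}$, $S_4=\{x=0,\ 0<y<1,\ 0<t<1\}$. Problem A: find a complex-valued function $U(x,y,t)$ in the class $W=\{U: U\in C(\overline\Omega)\cap C^{2,1,1}_{x,y,t}(\Omega)\}$ (i.e. $U$ is continuous on $\overline\Omega$ and is twice continuously differentiable in $x$, once in $y$ and once in $t$ in the open set $\Omega$) satisfying in $\Omega$ the equation $$t^k y^m U_{xx}-t^k x^n U_y-x^n y^m U_t-\Lambda x^n y^m t^k U=0,$$ the boundary condition $U=0$ on $S_2\cup S_4$, and the non-local conditions $$U(x,0,t)=\beta\,U(x,1,t)\ \text{ for all } x,t\in[0,1],\qquad U(x,y,0)=\gamma\,U(x,y,1)\ \text{ for all } x,y\in[0,1].$$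 *)

theory Defs
  imports "HOL-Analysis.Analysis"
begin

definition Omega :: "(real \<times> real \<times> real) set" where
  "Omega = {(x, y, t). 0 < x \<and> x < 1 \<and> 0 < y \<and> y < 1 \<and> 0 < t \<and> t < 1}"

definition S2 :: "(real \<times> real \<times> real) set" where
  "S2 = {(x, y, t). x = 1 \<and> 0 < y \<and> y < 1 \<and> 0 < t \<and> t < 1}"

definition S4 :: "(real \<times> real \<times> real) set" where
  "S4 = {(x, y, t). x = 0 \<and> 0 < y \<and> y < 1 \<and> 0 < t \<and> t < 1}"

text \<open>The slices \<open>real \<Rightarrow> complex\<close> are differentiated with \<open>vector_derivative\<close>, whose value is
  unspecified where the slice is not differentiable; existence of the derivatives is therefore
  demanded separately in \<open>C211\<close>.\<close>

definition d_x :: "(real \<times> real \<times> real \<Rightarrow> complex) \<Rightarrow> real \<times> real \<times> real \<Rightarrow> complex" where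
  "d_x U = (\<lambda>(x, y, t). vector_derivative (\<lambda>s. U (s, y, t)) (at x))"

definition d_y :: "(real \<times> real \<times> real \<Rightarrow> complex) \<Rightarrow> real \<times> real \<times> real \<Rightarrow> complex" where
  "d_y U = (\<lambda>(x, y, t). vector_derivative (\<lambda>s. U (x, s, t)) (at y))"

definition d_t :: "(real \<times> real \<times> real \<Rightarrow> complex) \<Rightarrow> real \<times> real \<times> real \<Rightarrow> complex" where
  "d_t U = (\<lambda>(x, y, t). vector_derivative (\<lambda>s. U (x, y, s)) (at t))"

definition C211 :: "(real \<times> real \<times> real) set \<Rightarrow> (real \<times> real \<times> real \<Rightarrow> complex) set" where
  "C211 S = {U.
     (\<forall>(x, y, t)\<in>S.
        (\<lambda>s. U (s, y, t)) differentiable (at x) \<and>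
        (\<lambda>s. d_x U (s, y, t)) differentiable (at x) \<and>
        (\<lambda>s. U (x, s, t)) differentiable (at y) \<and>
        (\<lambda>s. U (x, y, s)) differentiable (at t)) \<and>
     continuous_on S U \<and>
     continuous_on S (d_x U) \<and> continuous_on S (d_x (d_x U)) \<and>
     continuous_on S (d_y U) \<and> continuous_on S (d_t U)}"

definition W :: "(real \<times> real \<times> real \<Rightarrow> complex) set" where
  "W = {U. continuous_on (closure Omega) U} \<inter> C211 Omega"

definition solves_problem_A ::
  "real \<Rightarrow> real \<Rightarrow> real \<Rightarrow> complex \<Rightarrow> complex \<Rightarrow> complex \<Rightarrow> (real \<times> real \<times> real \<Rightarrow> complex) \<Rightarrow> bool" where
  "solves_problem_A m n k \<Lambda> \<beta> \<gamma> U \<longleftrightarrow>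
     U \<in> W \<and>
     (\<forall>(x, y, t)\<in>Omega.
        of_real (t powr k * y powr m) * d_x (d_x U) (x, y, t)
        - of_real (t powr k * x powr n) * d_y U (x, y, t)
        - of_real (x powr n * y powr m) * d_t U (x, y, t)
        - \<Lambda> * of_real (x powr n * y powr m * t powr k) * U (x, y, t) = 0) \<and>
     (\<forall>p\<in>S2 \<union> S4. U p = 0) \<and>
     (\<forall>x\<in>{0..1}. \<forall>t\<in>{0..1}. U (x, 0, t) = \<beta> * U (x, 1, t)) \<and>
     (\<forall>x\<in>{0..1}. \<forall>y\<in>{0..1}. U (x, y, 0) = \<gamma> * U (x, y, 1))"

end

theory Submission
  imports Defs
begin

text \<open>The squared modulus \<open>w\<close> of the difference of two solutions is a subsolution of a degenerate
  parabolic equation in which both \<open>y\<close> and \<open>t\<close> play the role of time. By the weak maximum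
  principle the maximum \<open>M\<close> of \<open>\<bar>U - V\<bar>\<close> is attained on \<open>x = 0\<close>, \<open>x = 1\<close>, \<open>y = 0\<close> or \<open>t = 0\<close>; there
  the boundary and non-local conditions give \<open>M \<le> max \<bar>\<beta>\<bar> \<bar>\<gamma>\<bar> * M\<close>, hence \<open>M = 0\<close>.\<close>

text \<open>If \<open>c\<close> were positive, \<open>f'\<close>, which vanishes at the interior
  maximum, would be positive just to the right of \<open>x\<close>, and the mean value theorem would
  give a larger value of \<open>f\<close> there.\<close>

lemma second_derivative_nonpos_at_max:
  fixes f f' :: "real \<Rightarrow> real"
  assumes ab: "a < x" "x < b"
    and f': "\<And>s. a < s \<Longrightarrow> s < b \<Longrightarrow> (f has_real_derivative f' s) (at s)"
    and f'': "(f' has_real_derivative c) (at x)"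
    and max: "\<And>s. a < s \<Longrightarrow> s < b \<Longrightarrow> f s \<le> f x"
  shows "c \<le> 0"
proof (rule ccontr)
  assume "\<not> c \<le> 0"
  then obtain d where d: "d > 0" "\<And>h. 0 < h \<Longrightarrow> h < d \<Longrightarrow> f' x < f' (x + h)"
    using has_real_derivative_pos_inc_right[OF f''] by auto
  have "f' x = 0"
    by (rule DERIV_local_max[OF f'[OF ab], where d = "min (x - a) (b - x)"]) (use ab max in auto)
  define h where "h = min d (b - x) / 2"
  have h: "0 < h" "h < d" "x + h < b"
    using d(1) ab by (auto simp: h_def min_def field_simps)
  obtain z where z: "x < z" "z < x + h" "f (x + h) - f x = (x + h - x) * f' z"
    using MVT2[of x "x + h" f f'] f' h ab by fastforce
  have "f' z > 0"
    using d(2)[of "z - x"] z h \<open>f' x = 0\<close> by simp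
  then have "f (x + h) > f x"
    using z(3) mult_pos_pos[OF h(1)] by fastforce
  with max[of "x + h"] h ab show False by simp
qed

text \<open>Values to the right of \<open>x\<close> are not compared, so this test also applies at a
  maximum on the upper end of the y- or t-range of a box.\<close>

lemma derivative_nonneg_at_left_max:
  fixes f :: "real \<Rightarrow> real"
  assumes "a < x" and f': "(f has_real_derivative c) (at x)"
    and max: "\<And>s. a < s \<Longrightarrow> s < x \<Longrightarrow> f s \<le> f x"
  shows "c \<ge> 0"
proof (rule ccontr)
  assume "\<not> c \<ge> 0"
  then obtain d where d: "d > 0" "\<And>h. 0 < h \<Longrightarrow> h < d \<Longrightarrow> f x < f (x - h)"
    using has_real_derivative_neg_dec_left[OF f'] by auto
  define h where "h = min d (x - a) / 2"
  have "0 < h" "h < d" "a < x - h"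
    using d(1) \<open>a < x\<close> by (auto simp: h_def min_def field_simps)
  with d(2)[of h] max[of "x - h"] show False by simp
qed

lemma has_real_derivative_inner:
  fixes f g :: "real \<Rightarrow> 'a::real_inner"
  assumes "(f has_vector_derivative f') (at x)" "(g has_vector_derivative g') (at x)"
  shows "((\<lambda>s. f s \<bullet> g s) has_real_derivative f x \<bullet> g' + f' \<bullet> g x) (at x)"
  unfolding has_real_derivative_iff_has_vector_derivative
  by (rule bounded_bilinear.has_vector_derivative[OF bounded_bilinear_inner assms])

lemma Omega_eq: "Omega = {0<..<1} \<times> {0<..<1} \<times> {0<..<1}"
  by (auto simp: Omega_def)

lemma closure_Omega: "closure Omega = {0..1} \<times> {0..1} \<times> {0..1}"
  by (simp add: Omega_eq closure_Times)

lemma closure_S2: "closure S2 = {1} \<times> {0..1} \<times> {0..1}"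
proof -
  have eq: "S2 = {1} \<times> {0<..<1} \<times> {0<..<1}" by (auto simp: S2_def)
  show ?thesis unfolding eq closure_Times by simp
qed

lemma closure_S4: "closure S4 = {0} \<times> {0..1} \<times> {0..1}"
proof -
  have eq: "S4 = {0} \<times> {0<..<1} \<times> {0<..<1}" by (auto simp: S4_def)
  show ?thesis unfolding eq closure_Times by simp
qed

text \<open>Half the second x-derivative of \<open>D \<bullet> D\<close> is
  \<open>D \<bullet> Dxx + Dx \<bullet> Dx\<close>. As \<open>a\<close> is nonnegative,
  \<open>subsol\<close> therefore makes the squared norm of \<open>D\<close> a subsolution. Both y
  and t act as time, so the final faces y = 1 and t = 1 do not occur in \<open>bdry\<close>.\<close>

lemma parabolic_maximum_principle:
  fixes D Dx Dxx Dy Dt :: "real \<times> real \<times> real \<Rightarrow> 'a::real_inner"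
    and a b c :: "real \<times> real \<times> real \<Rightarrow> real"
  assumes cont: "continuous_on (closure Omega) D"
    and Dx: "\<And>x y t. (x, y, t) \<in> Omega \<Longrightarrow>
      ((\<lambda>s. D (s, y, t)) has_vector_derivative Dx (x, y, t)) (at x)"
    and Dxx: "\<And>x y t. (x, y, t) \<in> Omega \<Longrightarrow>
      ((\<lambda>s. Dx (s, y, t)) has_vector_derivative Dxx (x, y, t)) (at x)"
    and Dy: "\<And>x y t. (x, y, t) \<in> Omega \<Longrightarrow>
      ((\<lambda>s. D (x, s, t)) has_vector_derivative Dy (x, y, t)) (at y)"
    and Dt: "\<And>x y t. (x, y, t) \<in> Omega \<Longrightarrow>
      ((\<lambda>s. D (x, y, s)) has_vector_derivative Dt (x, y, t)) (at t)"
    and coeffs: "\<And>p. p \<in> Omega \<Longrightarrow> a p \<ge> 0 \<and> b p > 0 \<and> c p > 0"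
    and subsol: "\<And>p. p \<in> Omega \<Longrightarrow>
      a p * (D p \<bullet> Dxx p) - b p * (D p \<bullet> Dy p) - c p * (D p \<bullet> Dt p) \<ge> 0"
    and bdry: "\<And>x y t. (x, y, t) \<in> closure Omega \<Longrightarrow> x = 0 \<or> x = 1 \<or> y = 0 \<or> t = 0 \<Longrightarrow>
      norm (D (x, y, t)) \<le> K"
    and p: "p \<in> closure Omega"
  shows "norm (D p) \<le> K"
proof -
  have "norm (D (0, 0, 0)) \<le> K"
    by (rule bdry) (auto simp: closure_Omega)
  then have "K \<ge> 0"
    using norm_ge_zero order_trans by blast
  have "norm (D q) \<le> K" if q: "q \<in> Omega" for q
  proof -
    obtain x0 Y T where q_eq: "q = (x0, Y, T)" by (cases q)
    have x0: "0 < x0" "x0 < 1" and Y: "0 < Y" "Y < 1" and T: "0 < T" "T < 1"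
      using q by (auto simp: q_eq Omega_def)
    have bound: "D q \<bullet> D q \<le> K\<^sup>2 + e" if "e > 0" for e
    proof -
      \<comment> \<open>The penalty \<open>\<epsilon> * (y + t)\<close> forces strictly positive y-
        and t-derivatives of the squared norm at a maximum of \<open>v\<close>. Since y + t is at
        most 2 on the cube, halving \<open>e\<close> keeps the total loss within
        \<open>e\<close>.\<close>
      define \<epsilon> where "\<epsilon> = e / 2"
      have \<epsilon>: "\<epsilon> > 0" using that by (simp add: \<epsilon>_def)
      define v where "v = (\<lambda>(x, y, t). D (x, y, t) \<bullet> D (x, y, t) - \<epsilon> * (y + t))"
      \<comment> \<open>The equation is not available at \<open>y = 1\<close> or \<open>t = 1\<close>, hence the smaller box.\<close>
      define B where "B = {0..1::real} \<times> {0..Y} \<times> {0..T}"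
      have "B \<subseteq> closure Omega"
        using Y T by (auto simp: B_def closure_Omega)
      then have "continuous_on B v"
        unfolding v_def case_prod_unfold
        by (auto intro!: continuous_intros continuous_on_subset[OF cont])
      moreover have "compact B" "B \<noteq> {}"
        using Y T by (auto simp: B_def intro!: compact_Times)
      ultimately obtain r where r: "r \<in> B" "\<And>r'. r' \<in> B \<Longrightarrow> v r' \<le> v r"
        using continuous_attains_sup[of B v] by blast
      obtain x y t where r_eq: "r = (x, y, t)" by (cases r)
      have rB: "0 \<le> x" "x \<le> 1" "0 \<le> y" "y \<le> Y" "0 \<le> t" "t \<le> T"
        using r(1) by (auto simp: r_eq B_def)
      have "x = 0 \<or> x = 1 \<or> y = 0 \<or> t = 0"
      proof (rule ccontr)
        assume "\<not> ?thesis"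
        then have xyt: "0 < x" "x < 1" "0 < y" "0 < t"
          using rB by auto
        then have r\<Omega>: "r \<in> Omega"
          using rB Y T by (simp add: r_eq Omega_def)
        \<comment> \<open>This is the second x-derivative of \<open>v\<close> at \<open>r\<close>,
          because the penalty is constant in x. The two gradient terms are nonnegative and can be
          discarded.\<close>
        have "D r \<bullet> Dxx r + Dx r \<bullet> Dx r + (Dx r \<bullet> Dx r + Dxx r \<bullet> D r) \<le> 0"
        proof (rule second_derivative_nonpos_at_max[OF xyt(1,2),
              where f = "\<lambda>s. v (s, y, t)"
                and f' = "\<lambda>s. D (s, y, t) \<bullet> Dx (s, y, t) + Dx (s, y, t) \<bullet> D (s, y, t)"])
          fix s :: real assume s: "0 < s" "s < 1"
          then have "(s, y, t) \<in> Omega" using r\<Omega> by (simp add: r_eq Omega_def)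
          then show "((\<lambda>s. v (s, y, t)) has_real_derivative
              D (s, y, t) \<bullet> Dx (s, y, t) + Dx (s, y, t) \<bullet> D (s, y, t)) (at s)"
            unfolding v_def by (auto intro!: derivative_eq_intros has_real_derivative_inner Dx)
          show "v (s, y, t) \<le> v (x, y, t)"
            using r(2)[of "(s, y, t)"] s rB by (simp add: r_eq B_def)
        next
          show "((\<lambda>s. D (s, y, t) \<bullet> Dx (s, y, t) + Dx (s, y, t) \<bullet> D (s, y, t))
              has_real_derivative D r \<bullet> Dxx r + Dx r \<bullet> Dx r + (Dx r \<bullet> Dx r + Dxx r \<bullet> D r)) (at x)"
            using r\<Omega> unfolding r_eq
            by (intro DERIV_add has_real_derivative_inner Dx Dxx)
        qed
        moreover have "Dx r \<bullet> Dx r \<ge> 0" by simp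
        ultimately have xx: "D r \<bullet> Dxx r \<le> 0"
          unfolding inner_commute[of "Dxx r"] by linarith
        \<comment> \<open>The maximum may lie on the face y = Y of \<open>B\<close>, so only smaller
          values of y are compared. The derivative of the penalty supplies the \<epsilon> that makes
          \<open>D r \<bullet> Dy r\<close> strictly positive. The same argument is repeated in
          t.\<close>
        have "D r \<bullet> Dy r + Dy r \<bullet> D r - \<epsilon> \<ge> 0"
        proof (rule derivative_nonneg_at_left_max[OF xyt(3), where f = "\<lambda>s. v (x, s, t)"])
          show "((\<lambda>s. v (x, s, t)) has_real_derivative D r \<bullet> Dy r + Dy r \<bullet> D r - \<epsilon>) (at y)"
            using r\<Omega> unfolding v_def r_eq prod.case
            by (intro DERIV_diff has_real_derivative_inner Dy) (auto intro!: derivative_eq_intros)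
          show "v (x, s, t) \<le> v (x, y, t)" if "0 < s" "s < y" for s
            using r(2)[of "(x, s, t)"] that rB by (simp add: r_eq B_def)
        qed
        then have yy: "D r \<bullet> Dy r > 0"
          using \<epsilon> by (simp add: inner_commute[of "Dy r"])
        have "D r \<bullet> Dt r + Dt r \<bullet> D r - \<epsilon> \<ge> 0"
        proof (rule derivative_nonneg_at_left_max[OF xyt(4), where f = "\<lambda>s. v (x, y, s)"])
          show "((\<lambda>s. v (x, y, s)) has_real_derivative D r \<bullet> Dt r + Dt r \<bullet> D r - \<epsilon>) (at t)"
            using r\<Omega> unfolding v_def r_eq prod.case
            by (intro DERIV_diff has_real_derivative_inner Dt) (auto intro!: derivative_eq_intros)
          show "v (x, y, s) \<le> v (x, y, t)" if "0 < s" "s < t" for s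
            using r(2)[of "(x, y, s)"] that rB by (simp add: r_eq B_def)
        qed
        then have tt: "D r \<bullet> Dt r > 0"
          using \<epsilon> by (simp add: inner_commute[of "Dt r"])
        have "a r * (D r \<bullet> Dxx r) \<le> 0" "b r * (D r \<bullet> Dy r) > 0" "c r * (D r \<bullet> Dt r) > 0"
          using coeffs[OF r\<Omega>] xx yy tt by (auto simp: mult_nonneg_nonpos)
        with subsol[OF r\<Omega>] show False by linarith
      qed
      then have "norm (D (x, y, t)) \<le> K"
        using r(1) \<open>B \<subseteq> closure Omega\<close> by (intro bdry) (auto simp: r_eq)
      then have "D r \<bullet> D r \<le> K\<^sup>2"
        by (simp add: r_eq dot_square_norm power_mono)
      moreover have "\<epsilon> * (y + t) \<ge> 0"
        using \<epsilon> rB by simp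
      ultimately have "v r \<le> K\<^sup>2"
        by (simp add: v_def r_eq)
      \<comment> \<open>The box \<open>B\<close> was cut at the y- and t-coordinates of
        \<open>q\<close>, so it still contains \<open>q\<close>.\<close>
      moreover have "v q \<le> v r"
        using x0 Y T by (intro r(2)) (simp add: q_eq B_def)
      moreover have "\<epsilon> * (Y + T) \<le> \<epsilon> * 2"
        using \<epsilon> Y T by (intro mult_left_mono) auto
      ultimately show ?thesis
        by (simp add: v_def q_eq \<epsilon>_def)
    qed
    have "(norm (D q))\<^sup>2 \<le> K\<^sup>2"
      using field_le_epsilon[OF bound] by (simp add: dot_square_norm)
    then show ?thesis
      using \<open>K \<ge> 0\<close> by (simp add: power2_le_iff_abs_le)
  qed
  \<comment> \<open>Continuity carries the bound from the open cube to its closure, and thereby to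
    the faces y = 1 and t = 1.\<close>
  then show ?thesis
    by (intro continuous_on_closure_norm_le[OF cont _ p]) auto
qed

lemma solves_problem_A_derivs:
  assumes "solves_problem_A m n k \<Lambda> \<beta> \<gamma> U" "(x, y, t) \<in> Omega"
  shows "((\<lambda>s. U (s, y, t)) has_vector_derivative d_x U (x, y, t)) (at x)"
    and "((\<lambda>s. d_x U (s, y, t)) has_vector_derivative d_x (d_x U) (x, y, t)) (at x)"
    and "((\<lambda>s. U (x, s, t)) has_vector_derivative d_y U (x, y, t)) (at y)"
    and "((\<lambda>s. U (x, y, s)) has_vector_derivative d_t U (x, y, t)) (at t)"
  using assms
  by (auto simp: solves_problem_A_def W_def C211_def d_x_def d_y_def d_t_def
      simp flip: vector_derivative_works)

text \<open>The boundary condition is imposed on relatively open faces only. Continuity extends it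
  to their edges, which the maximum principle also needs.\<close>

lemma solves_problem_A_lateral:
  assumes "solves_problem_A m n k \<Lambda> \<beta> \<gamma> U" "(x, y, t) \<in> closure Omega" "x = 0 \<or> x = 1"
  shows "U (x, y, t) = 0"
proof -
  have U: "continuous_on (closure Omega) U" "\<And>p. p \<in> S2 \<union> S4 \<Longrightarrow> U p = 0"
    using assms(1) by (auto simp: solves_problem_A_def W_def)
  have "continuous_on (closure S2) U" "continuous_on (closure S4) U"
    by (auto intro!: continuous_on_subset[OF U(1)] simp: closure_Omega closure_S2 closure_S4)
  moreover have "(x, y, t) \<in> closure S2 \<or> (x, y, t) \<in> closure S4"
    using assms(2,3) by (auto simp: closure_Omega closure_S2 closure_S4)
  ultimately show ?thesis
    using continuous_constant_on_closure[of S2 U 0] continuous_constant_on_closure[of S4 U 0] U(2)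
    by blast
qed

theorem theorem2:
  fixes m n k :: real
    and \<Lambda>11 \<Lambda>12 \<Lambda>21 \<Lambda>22 \<beta>1 \<beta>2 \<gamma>1 \<gamma>2 :: real
    and \<Lambda> \<beta> \<gamma> :: complex
    and U V :: "real \<times> real \<times> real \<Rightarrow> complex"
  assumes "m > 0" and "n > 0" and "k > 0"
    and "\<Lambda> = of_real (\<Lambda>11 + \<Lambda>21) + \<i> * of_real (\<Lambda>12 + \<Lambda>22)"
    and "\<beta> = of_real \<beta>1 + \<i> * of_real \<beta>2"
    and "\<gamma> = of_real \<gamma>1 + \<i> * of_real \<gamma>2"
    and "\<beta>1\<^sup>2 + \<beta>2\<^sup>2 < 1"
    and "\<gamma>1\<^sup>2 + \<gamma>2\<^sup>2 < 1"
    and "\<Lambda>11 + \<Lambda>21 \<ge> 0"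
    and "solves_problem_A m n k \<Lambda> \<beta> \<gamma> U"
    and "solves_problem_A m n k \<Lambda> \<beta> \<gamma> V"
  shows "\<forall>p\<in>closure Omega. U p = V p"
proof -
  have UV: "solves_problem_A m n k \<Lambda> \<beta> \<gamma> U" "solves_problem_A m n k \<Lambda> \<beta> \<gamma> V"
    using assms by auto
  have \<beta>: "norm \<beta> < 1" and \<gamma>: "norm \<gamma> < 1" and \<Lambda>: "Re \<Lambda> \<ge> 0"
    using assms(4-9) by (auto simp: cmod_def real_sqrt_lt_1_iff)
  define D where "D = (\<lambda>p. U p - V p)"
  have cont: "continuous_on (closure Omega) D"
    using UV unfolding D_def
    by (intro continuous_on_diff) (auto simp: solves_problem_A_def W_def)
  have "compact (closure Omega)" "closure Omega \<noteq> {}"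
    by (auto simp: closure_Omega intro!: compact_Times)
  then obtain r where r: "r \<in> closure Omega" "\<And>p. p \<in> closure Omega \<Longrightarrow> norm (D p) \<le> norm (D r)"
    using continuous_attains_sup[of "closure Omega" "\<lambda>p. norm (D p)"] continuous_on_norm[OF cont]
    by blast
  define M where "M = norm (D r)"
  \<comment> \<open>A single factor below 1 serves both non-local conditions, so \<kappa> * M bounds
    D on all four faces required by the maximum principle. Applying that principle at the maximum
    point \<open>r\<close> yields M \<le> \<kappa> * M.\<close>
  define \<kappa> where "\<kappa> = max (norm \<beta>) (norm \<gamma>)"
  have \<kappa>: "\<kappa> < 1" "0 \<le> \<kappa>" "norm \<beta> \<le> \<kappa>" "norm \<gamma> \<le> \<kappa>"
    using \<beta> \<gamma> by (auto simp: \<kappa>_def le_max_iff_disj)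
  have "norm (D r) \<le> \<kappa> * M"
  proof (rule parabolic_maximum_principle[OF cont, where
        Dx = "\<lambda>p. d_x U p - d_x V p" and Dxx = "\<lambda>p. d_x (d_x U) p - d_x (d_x V) p" and
        Dy = "\<lambda>p. d_y U p - d_y V p" and Dt = "\<lambda>p. d_t U p - d_t V p" and
        a = "\<lambda>(x, y, t). t powr k * y powr m" and
        b = "\<lambda>(x, y, t). t powr k * x powr n" and
        c = "\<lambda>(x, y, t). x powr n * y powr m"])
    fix p assume p: "p \<in> Omega"
    obtain x y t where p_eq: "p = (x, y, t)" by (cases p)
    let ?a = "t powr k * y powr m" and ?b = "t powr k * x powr n" and ?c = "x powr n * y powr m"
    let ?d = "x powr n * y powr m * t powr k"
    let ?xx = "d_x (d_x U) p - d_x (d_x V) p" and ?y = "d_y U p - d_y V p"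
      and ?t = "d_t U p - d_t V p"
    show "0 \<le> (case p of (x, y, t) \<Rightarrow> t powr k * y powr m) \<and>
        0 < (case p of (x, y, t) \<Rightarrow> t powr k * x powr n) \<and>
        0 < (case p of (x, y, t) \<Rightarrow> x powr n * y powr m)"
      using p by (auto simp: p_eq Omega_def)
    have "of_real ?a * d_x (d_x F) p - of_real ?b * d_y F p - of_real ?c * d_t F p
        - \<Lambda> * of_real ?d * F p = 0" if "solves_problem_A m n k \<Lambda> \<beta> \<gamma> F" for F
      using that p unfolding solves_problem_A_def p_eq by blast
    from this[OF UV(1)] this[OF UV(2)]
    have "?a *\<^sub>R ?xx - ?b *\<^sub>R ?y - ?c *\<^sub>R ?t = ?d *\<^sub>R (\<Lambda> * D p)"
      unfolding D_def scaleR_conv_of_real by algebra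
    \<comment> \<open>Pairing the linear equation for the difference with \<open>D p\<close> in the
      real inner product of the complex plane gives the real relation that \<open>subsol\<close>
      asks for.\<close>
    then have "?a * (D p \<bullet> ?xx) - ?b * (D p \<bullet> ?y) - ?c * (D p \<bullet> ?t) = ?d * (D p \<bullet> (\<Lambda> * D p))"
      by (metis inner_diff_right inner_scaleR_right)
    \<comment> \<open>Multiplication by \<i> rotates \<open>D p\<close> to an orthogonal vector, so
      the imaginary part of \<Lambda> drops out and the sign of \<open>Re \<Lambda>\<close>
      decides.\<close>
    moreover have "D p \<bullet> (\<Lambda> * D p) = Re \<Lambda> * (norm (D p))\<^sup>2"
      by (simp add: inner_complex_def cmod_power2 algebra_simps flip: power2_eq_square)
    ultimately show "0 \<le> (case p of (x, y, t) \<Rightarrow> t powr k * y powr m) * (D p \<bullet> ?xx)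
        - (case p of (x, y, t) \<Rightarrow> t powr k * x powr n) * (D p \<bullet> ?y)
        - (case p of (x, y, t) \<Rightarrow> x powr n * y powr m) * (D p \<bullet> ?t)"
      using \<Lambda> by (simp add: p_eq)
  next
    fix x y t assume p: "(x, y, t) \<in> closure Omega" "x = 0 \<or> x = 1 \<or> y = 0 \<or> t = 0"
    then have xyt: "x \<in> {0..1}" "y \<in> {0..1}" "t \<in> {0..1}"
      by (auto simp: closure_Omega)
    have M: "norm (D p) \<le> M" if "p \<in> closure Omega" for p
      using r(2)[OF that] by (simp add: M_def)
    \<comment> \<open>The non-local conditions express D at y = 0 or t = 0 through its value on the
      opposite face, where the global maximum M is the available bound. The factor \<beta> or
      \<gamma> then shrinks it.\<close>
    have *: "norm (z * D q) \<le> \<kappa> * M" if "norm z \<le> \<kappa>" "q \<in> closure Omega" for z q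
      unfolding norm_mult using that M \<kappa> by (intro mult_mono) auto
    from p(2) consider "x = 0 \<or> x = 1" | "y = 0" | "t = 0" by blast
    then show "norm (D (x, y, t)) \<le> \<kappa> * M"
    proof cases
      case 1
      then have "D (x, y, t) = 0"
        using solves_problem_A_lateral[OF UV(1) p(1)] solves_problem_A_lateral[OF UV(2) p(1)]
        by (simp add: D_def)
      then show ?thesis
        using \<kappa> by (simp add: M_def)
    next
      case 2
      then have "D (x, y, t) = \<beta> * D (x, 1, t)"
        using UV xyt by (simp add: solves_problem_A_def D_def algebra_simps)
      then show ?thesis
        using *[OF \<kappa>(3), of "(x, 1, t)"] xyt by (simp add: closure_Omega)
    next
      case 3
      then have "D (x, y, t) = \<gamma> * D (x, y, 1)"
        using UV xyt by (simp add: solves_problem_A_def D_def algebra_simps)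
      then show ?thesis
        using *[OF \<kappa>(4), of "(x, y, 1)"] xyt by (simp add: closure_Omega)
    qed
  qed (use r UV in \<open>auto simp: D_def
      intro!: has_vector_derivative_diff solves_problem_A_derivs\<close>)
  then have "(1 - \<kappa>) * M \<le> 0"
    by (simp add: M_def algebra_simps)
  then have "M \<le> 0"
    using \<kappa> by (simp add: mult_le_0_iff)
  then show ?thesis
    using r(2) by (force simp: M_def D_def)
qed

end
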